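(* There exists a Banach limit $B\in\ell_\infty^*$ such that $B(\sigma_m x)=B(x)$ for every integer $m\ge 2$ and every $x\in\ell_\infty$ (that is, $B\in\Sigma:=\bigcap_{m=2}^\infty \mathfrak{B}(\sigma_m)$), but $B\notin\mathfrak{B}(C)$, that is, $B$ is not invariant with respect to the Cesàro operator $C$: there is some $x\in\ell_\infty$ with $B(Cx)\neq B(x)$.
   Context: $\mathbb{N}=\{1,2,3,\ldots\}$, and $\ell_\infty$ is the space of all bounded (real) sequences $x=(x_1,x_2,\ldots)$ with the norm $\|x\|_{\ell_\infty}=\sup_{n\in\mathbb{N}}|x_n|$ and the usual coordinatewise partial order; $\ell_\infty^*$ is its dual. A linear functional $B\in\ell_\infty^*$ is a Banach limit if (1) $B\ge 0$, i.e. $Bx\ge 0$ for every $x\ge 0$; (2) $B(\mathbf{1})=1$, where $\mathbf{1}=(1,1,\ldots)$; (3) $B(Tx)=B(x)$ for every $x\in\ell_\infty$, where $T(x_1,x_2,\ldots)=(0,x_1,x_2,\ldots)$. The set of all Banach limits is denoted $\mathfrak{B}$. For a linear operator $H:\ell_\infty\to\ell_\infty$, $\mathfrak{B}(H)=\{B\in\mathfrak{B}: B(Hx)=B(x)\text{ for all }x\in\ell_\infty\}$. For $m\in\mathbb{N}$ the dilation operator $\sigma_m:\ell_\infty\to\ell_\infty$ is $\sigma_m(x_1,x_2,\ldots)=(\underbrace{x_1,\ldots,x_1}_{m},\underbrace{x_2,\ldots,x_2}_{m},\ldots)$. The Cesàro operator $C:\ell_\infty\to\ell_\infty$ is $(Cx)_n=\frac1n\sum_{k=1}^n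 x_k$, $n\ge 1$. *)

theory Defs
  imports "HOL-Analysis.Analysis"
begin

text \<open>
  The space \<open>\<ell>\<^sub>\<infinity>\<close> is rendered as the bounded continuous real functions on the discrete
  space of natural numbers; every function on \<^typ>\<open>nat\<close> is continuous, and the norm of
  \<^typ>\<open>nat \<Rightarrow>\<^sub>C real\<close> is the supremum norm (see \<open>norm_linf\<close>). Indices start at \<open>0\<close>:
  the coordinate \<open>x\<^sub>n\<close> (\<open>n \<ge> 1\<close>) is \<open>apply_bcontfun x (n - 1)\<close>. The coordinate formulas below
  are the usual ones after this shift; for the dilation and the Cesaro operator the 1-based
  forms are lemmas.
\<close>

type_synonym linf = "nat \<Rightarrow>\<^sub>C real"

type_synonym linf_dual = "linf \<Rightarrow>\<^sub>L real"

lemma bounded_imp_bcontfun_nat: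
  fixes f :: "nat \<Rightarrow> 'a::metric_space"
  shows "bounded (range f) \<Longrightarrow> f \<in> bcontfun"
  by (simp add: bcontfun_def)

lemma norm_linf: "norm (x :: linf) = (SUP n. \<bar>apply_bcontfun x n\<bar>)"
  by (simp add: norm_bcontfun_def dist_bcontfun.rep_eq)

context
  includes bcontfun.lifting
begin

lift_definition shift :: "linf \<Rightarrow> linf"
  is "\<lambda>x i. if i = 0 then 0 else x (i - 1)"
proof (rule bounded_imp_bcontfun_nat)
  fix x :: "nat \<Rightarrow> real"
  assume "x \<in> bcontfun"
  then have "bounded (insert 0 (range x))"
    by (simp add: bcontfun_def)
  then show "bounded (range (\<lambda>i. if i = 0 then 0 else x (i - 1)))"
    by (rule bounded_subset) auto
qed

text \<open>The junk value \<open>m = 0\<close> (where \<open>i div 0 = 0\<close>) is never used.\<close>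

lift_definition dilation :: "nat \<Rightarrow> linf \<Rightarrow> linf"
  is "\<lambda>m x i. x (i div m)"
proof (rule bounded_imp_bcontfun_nat)
  fix m :: nat and x :: "nat \<Rightarrow> real"
  assume "x \<in> bcontfun"
  then have "bounded (range x)"
    by (simp add: bcontfun_def)
  then show "bounded (range (\<lambda>i. x (i div m)))"
    by (rule bounded_subset) auto
qed

lift_definition cesaro :: "linf \<Rightarrow> linf"
  is "\<lambda>x i. (1 / real (i + 1)) * (\<Sum>k\<le>i. x k)"
proof (rule bounded_imp_bcontfun_nat)
  fix x :: "nat \<Rightarrow> real"
  assume "x \<in> bcontfun"
  then obtain K where K: "\<bar>x k\<bar> \<le> K" for k
    by (auto simp: bcontfun_def bounded_iff)
  have "\<bar>(1 / real (i + 1)) * (\<Sum>k\<le>i. x k)\<bar> \<le> K" for i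
  proof -
    have "\<bar>\<Sum>k\<le>i. x k\<bar> \<le> (\<Sum>k\<le>i. \<bar>x k\<bar>)"
      by (rule sum_abs)
    also have "\<dots> \<le> real (i + 1) * K"
      using sum_bounded_above[of "{..i}" "\<lambda>k. \<bar>x k\<bar>" K] K by simp
    finally show ?thesis
      by (simp add: abs_mult field_simps)
  qed
  then show "bounded (range (\<lambda>i. (1 / real (i + 1)) * (\<Sum>k\<le>i. x k)))"
    by (auto simp: bounded_iff)
qed

end

lemma dilation_1based:
  assumes "m \<ge> 1" "n \<ge> 1" "1 \<le> j" "j \<le> m"
  shows "apply_bcontfun (dilation m x) ((m * (n - 1) + j) - 1) = apply_bcontfun x (n - 1)"
proof -
  have "(m * (n - 1) + j) - 1 = m * (n - 1) + (j - 1)"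
    using assms by simp
  moreover have "(m * (n - 1) + (j - 1)) div m = n - 1"
    using assms by (subst div_mult_self4) auto
  ultimately show ?thesis
    by (simp add: dilation.rep_eq)
qed

lemma cesaro_1based:
  assumes "n \<ge> 1"
  shows "apply_bcontfun (cesaro x) (n - 1) = (1 / real n) * (\<Sum>k = 1..n. apply_bcontfun x (k - 1))"
proof -
  have "(\<Sum>k\<le>n - 1. apply_bcontfun x k) = (\<Sum>k = 1..n. apply_bcontfun x (k - 1))"
    using assms by (intro sum.reindex_bij_witness[of _ "\<lambda>k. k - 1" Suc]) auto
  then show ?thesis
    using assms by (simp add: cesaro.rep_eq)
qed

lemma linear_shift: "linear shift"
  by (rule linearI) (auto intro!: bcontfun_eqI simp: shift.rep_eq)

lemma linear_dilation: "linear (dilation m)"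
  by (rule linearI) (auto intro!: bcontfun_eqI simp: dilation.rep_eq)

lemma linear_cesaro: "linear cesaro"
  by (rule linearI)
    (auto intro!: bcontfun_eqI simp: cesaro.rep_eq sum.distrib sum_distrib_left sum_divide_distrib algebra_simps)

definition banach_limits :: "linf_dual set" where
  "banach_limits = {B.
     (\<forall>x :: linf. (\<forall>n. 0 \<le> apply_bcontfun x n) \<longrightarrow> 0 \<le> blinfun_apply B x) \<and>
     blinfun_apply B (const_bcontfun 1) = 1 \<and>
     (\<forall>x. blinfun_apply B (shift x) = blinfun_apply B x)}"

definition invariant_banach_limits :: "(linf \<Rightarrow> linf) \<Rightarrow> linf_dual set" where
  "invariant_banach_limits H =
     {B \<in> banach_limits. \<forall>x. blinfun_apply B (H x) = blinfun_apply B x}"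

end

theory Submission
  imports Defs
begin

text \<open>
  The indicator sequence \<open>s\<close> of a suitable very sparse set separates \<open>B (C s)\<close> from \<open>B s\<close>. The set
  contains long intervals \<open>W\<^sub>N\<close> (\<open>window\<close>), so that a limit of averages over the \<open>W\<^sub>N\<close> is a Banach
  limit with value \<open>1\<close> at \<open>s\<close>. It is also sparse at every scale comparable to \<open>W\<^sub>N\<close>, so that
  the Cesaro means of \<open>s\<close> are small on \<open>W\<^sub>N\<close> and the same Banach limit has value \<open>0\<close> at \<open>C s\<close>.

  Invariance under dilations has to be added without losing these two values. Banach limits
  are mapped to Banach limits by \<open>\<phi> \<mapsto> \<phi> \<circ> \<sigma>\<^sub>m\<close>, because \<open>\<sigma>\<^sub>m T = T\<^sup>m \<sigma>\<^sub>m\<close>, and these maps commute, because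
  \<open>\<sigma>\<^sub>m \<sigma>\<^sub>n = \<sigma>\<^bsub>mn\<^esub>\<close>. As in the Markov-Kakutani fixed point theorem, averages along the orbit of \<open>\<phi>\<close>
  have a dilation-invariant cluster point \<open>\<psi>\<close>, and \<open>\<psi>\<close> vanishes at every sequence at which all
  the functionals \<open>\<phi> \<circ> \<sigma>\<^sub>m\<close> vanish (\<open>dilation_invariant_state\<close>). Hence it is enough to find a shift-invariant
  \<open>\<phi>\<close> with \<open>\<phi> (\<sigma>\<^sub>m s) = 1\<close> and \<open>\<phi> (\<sigma>\<^sub>m (C s)) = 0\<close> for every \<open>m \<ge> 1\<close>
  (\<open>shift_invariant_state_separating_shadow\<close>).

  This dictates the set. The first condition holds if the set contains \<open>\<lfloor>n / m\<rfloor>\<close> for every \<open>n \<in> W\<^sub>N\<close> and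
  every \<open>m \<le> N\<close> (\<open>shadow\<close>), since each fixed \<open>m\<close> is covered from \<open>N = m\<close> on. This adds about \<open>N\<^sup>2\<close> points for each \<open>N\<close>.
  If the windows move to infinity fast enough, the points that come from later windows lie beyond \<open>W\<^sub>N\<close>, while
  the at most \<open>N\<^sup>3\<close> points that come from \<open>W\<^sub>1, \<dots>, W\<^sub>N\<close> are negligible compared with the position of
  \<open>W\<^sub>N\<close>. This gives the second condition.

  Both limits, of the window averages and of the orbit averages, are cluster points in the
  compact set of states (\<open>state_cluster_point\<close>).
\<close>

section \<open>States and their cluster points\<close>

text \<open>
  States are plain functions and not elements of the dual space because their compactness is
  the one of the product topology on \<^typ>\<open>linf \<Rightarrow> real\<close>.
\<close>

definition state :: "(linf \<Rightarrow> real) \<Rightarrow> bool" where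
  "state \<phi> \<longleftrightarrow> linear \<phi> \<and> (\<forall>x. (\<forall>n. 0 \<le> apply_bcontfun x n) \<longrightarrow> 0 \<le> \<phi> x) \<and>
     \<phi> (const_bcontfun 1) = 1"

lemma state_linear: "state \<phi> \<Longrightarrow> linear \<phi>"
  and state_nonneg: "state \<phi> \<Longrightarrow> (\<And>n. 0 \<le> apply_bcontfun x n) \<Longrightarrow> 0 \<le> \<phi> x"
  and state_one: "state \<phi> \<Longrightarrow> \<phi> (const_bcontfun 1) = 1"
  by (simp_all add: state_def)

text \<open>
  Both \<open>\<parallel>x\<parallel> \<cdot> 1 - x\<close> and \<open>\<parallel>x\<parallel> \<cdot> 1 + x\<close> are nonnegative. The bound makes states continuous and confines
  them to a compact box.
\<close>

lemma state_abs_le_norm: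
  assumes "state \<phi>"
  shows "\<bar>\<phi> x\<bar> \<le> norm x"
proof -
  let ?c = "norm x *\<^sub>R (const_bcontfun 1 :: linf)"
  have c: "\<phi> ?c = norm x"
    using assms by (simp add: state_linear linear_scale state_one)
  have bound: "apply_bcontfun x n \<le> norm x" "0 \<le> norm x + apply_bcontfun x n" for n
    using norm_bounded[of x n] by (simp_all add: abs_le_iff)
  have "0 \<le> \<phi> (?c - x)" "0 \<le> \<phi> (?c + x)"
    by (rule state_nonneg[OF assms], simp add: const_bcontfun.rep_eq bound)+
  then show ?thesis
    using assms by (simp add: state_linear linear_diff linear_add c)
qed

lemma compact_coordinate_box: "compact {f. \<forall>x. \<bar>f x\<bar> \<le> (r x :: real)}"
proof -
  have "compactin (product_topology (\<lambda>x. euclidean) UNIV) (PiE UNIV (\<lambda>x. {- r x .. r x}))"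
    by (simp add: compactin_PiE)
  moreover have "PiE UNIV (\<lambda>x. {- r x .. r x}) = {f. \<forall>x. \<bar>f x\<bar> \<le> r x}"
    by (auto simp: PiE_def Pi_def abs_le_iff minus_le_iff)
  ultimately show ?thesis
    by (simp add: euclidean_product_topology)
qed

text \<open>
  The source of all limits below: by Tychonoff's theorem the sequence has a cluster point \<open>\<psi>\<close> in
  the topology of pointwise convergence. Each coordinate \<open>f \<mapsto> f x\<close> tends to \<open>\<psi> x\<close> along a proper filter
  finer than that of the sequence, so \<open>\<psi>\<close> inherits the identities and inequalities between
  coordinates that all states satisfy, and its value is the limit wherever there is one.
\<close>

lemma state_cluster_point:
  assumes "\<And>n. state (\<phi> n)"
  obtains \<psi> where "state \<psi>"
    and "\<And>x l. (\<lambda>n::nat. \<phi> n x) \<longlonglongrightarrow> l \<Longrightarrow> \<psi> x = l"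
proof -
  let ?F = "filtermap \<phi> sequentially"
  have ev: "eventually P ?F" if "\<And>f. state f \<Longrightarrow> P f" for P
    using that assms by (simp add: eventually_filtermap)
  have "eventually (\<lambda>f. f \<in> {f. \<forall>x. \<bar>f x\<bar> \<le> norm x}) ?F"
    by (rule ev) (simp add: state_abs_le_norm)
  moreover have "?F \<noteq> bot"
    by (simp add: filtermap_bot_iff)
  ultimately obtain \<psi> where \<psi>: "inf (nhds \<psi>) ?F \<noteq> bot"
    using compact_coordinate_box[of "norm :: linf \<Rightarrow> real"] by (auto simp: compact_filter)
  \<comment> \<open>Along \<open>G\<close>, points tend to \<open>\<psi>\<close> and have every property that the sequence has eventually.\<close>
  define G where "G = inf (nhds \<psi>) ?F"
  have G: "G \<noteq> bot" "G \<le> nhds \<psi>" "G \<le> ?F"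
    using \<psi> by (simp_all add: G_def)
  have coord: "((\<lambda>f. f x) \<longlongrightarrow> \<psi> x) G" for x
  proof -
    have "continuous_on UNIV (\<lambda>f :: linf \<Rightarrow> real. f x)"
      by (rule continuous_on_product_coordinates)
    then have "((\<lambda>f. f x) \<longlongrightarrow> \<psi> x) (nhds \<psi>)"
      using continuous_on_tendsto_compose[of UNIV "\<lambda>f. f x" "\<lambda>f. f" \<psi> "nhds \<psi>"]
      by (simp add: filterlim_def)
    then show ?thesis
      using G(2) by (rule tendsto_mono[rotated])
  qed
  have evG: "eventually P G" if "\<And>f. state f \<Longrightarrow> P f" for P
    using ev[OF that] G(3) by (auto simp: le_filter_def)
  have add: "\<psi> (x + y) = \<psi> x + \<psi> y" for x y
  proof (rule tendsto_unique[OF G(1)])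
    show "((\<lambda>f. f (x + y)) \<longlongrightarrow> \<psi> (x + y)) G"
      by (rule coord)
    show "((\<lambda>f. f (x + y)) \<longlongrightarrow> \<psi> x + \<psi> y) G"
      by (rule Lim_transform_eventually[OF tendsto_add[OF coord coord]])
        (rule evG, simp add: state_linear linear_add)
  qed
  have scale: "\<psi> (c *\<^sub>R x) = c *\<^sub>R \<psi> x" for c x
  proof (rule tendsto_unique[OF G(1)])
    show "((\<lambda>f. f (c *\<^sub>R x)) \<longlongrightarrow> \<psi> (c *\<^sub>R x)) G"
      by (rule coord)
    show "((\<lambda>f. f (c *\<^sub>R x)) \<longlongrightarrow> c *\<^sub>R \<psi> x) G"
      by (rule Lim_transform_eventually[OF tendsto_scaleR[OF tendsto_const coord]])
        (rule evG, simp add: state_linear linear_scale)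
  qed
  have lim: "\<psi> x = l" if "(\<lambda>n. \<phi> n x) \<longlonglongrightarrow> l" for x l
  proof (rule tendsto_unique[OF G(1) coord])
    have "((\<lambda>f. f x) \<longlongrightarrow> l) ?F"
      using that by (simp add: filterlim_filtermap)
    then show "((\<lambda>f. f x) \<longlongrightarrow> l) G"
      using G(3) by (rule tendsto_mono[rotated])
  qed
  have "0 \<le> \<psi> x" if "\<And>n. 0 \<le> apply_bcontfun x n" for x
  proof (rule tendsto_lowerbound[OF coord _ G(1)])
    show "eventually (\<lambda>f. 0 \<le> f x) G"
      by (rule evG) (rule state_nonneg[OF _ that])
  qed
  moreover have "\<psi> (const_bcontfun 1) = 1"
    by (rule lim) (simp add: assms state_one)
  ultimately have "state \<psi>"
    using linearI[OF add scale] by (simp add: state_def)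
  with lim show thesis
    using that by blast
qed

lemma state_average:
  assumes "finite I" "I \<noteq> {}" "\<And>i. i \<in> I \<Longrightarrow> state (\<phi> i)"
  shows "state (\<lambda>x. (\<Sum>i\<in>I. \<phi> i x) / real (card I))"
proof -
  have "linear (\<lambda>x. (\<Sum>i\<in>I. \<phi> i x) / real (card I))"
    using assms(3)
    by (intro linearI)
      (simp_all add: state_linear linear_add linear_scale sum.distrib add_divide_distrib
        sum_distrib_left[symmetric])
  then show ?thesis
    using assms by (auto simp: state_def intro!: divide_nonneg_nonneg sum_nonneg)
qed

section \<open>Dilation-invariant states\<close>

lemma dilation_dilation: "dilation m (dilation n x) = dilation (m * n) x"
  by (rule bcontfun_eqI) (simp add: dilation.rep_eq div_mult2_eq)

lemma dilation_1 [simp]: "dilation (Suc 0) x = x"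
  by (rule bcontfun_eqI) (simp add: dilation.rep_eq)

lemma state_dilation:
  assumes "state \<phi>"
  shows "state (\<lambda>x. \<phi> (dilation m x))"
proof -
  have "linear (\<lambda>x. \<phi> (dilation m x))"
    using linear_compose[OF linear_dilation state_linear[OF assms]] by (simp add: o_def)
  moreover have "dilation m (const_bcontfun 1) = const_bcontfun 1"
    by (rule bcontfun_eqI) (simp add: dilation.rep_eq const_bcontfun.rep_eq)
  ultimately show ?thesis
    using assms by (simp add: state_def dilation.rep_eq)
qed

text \<open>
  The averages of \<open>\<phi> \<circ> \<sigma>\<^sub>m\<^sup>e\<close> over \<open>e \<le> k\<close> change by at most \<open>2 \<parallel>x\<parallel> / (k + 1)\<close> under \<open>\<sigma>\<^sub>m\<close>, by
  telescoping. The last conclusion transports every linear identity that holds along the orbit of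
  \<open>\<phi>\<close>, in particular invariance under other dilations, to the new state.
\<close>

lemma add_dilation_invariance:
  assumes "state \<phi>"
  obtains \<psi> where "state \<psi>"
    and "\<And>x. \<psi> (dilation m x) = \<psi> x"
    and "\<And>x. (\<And>e. \<phi> (dilation (m ^ e) x) = 0) \<Longrightarrow> \<psi> x = 0"
proof -
  define avg where "avg k x = (\<Sum>e\<in>{..k}. \<phi> (dilation (m ^ e) x)) / real (card {..k})" for k x
  have "state (avg k)" for k
    unfolding avg_def by (rule state_average) (auto intro: state_dilation assms)
  then obtain \<psi> where \<psi>: "state \<psi>" "\<And>x l. (\<lambda>k. avg k x) \<longlonglongrightarrow> l \<Longrightarrow> \<psi> x = l"
    using state_cluster_point[of avg] by blast
  have "\<psi> (dilation m x) = \<psi> x" for x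
  proof -
    have "avg k (dilation m x - x) = (\<phi> (dilation (m ^ Suc k) x) - \<phi> x) / real (Suc k)" for k
    proof -
      have "(\<Sum>e\<le>k. \<phi> (dilation (m ^ e) (dilation m x - x))) =
          (\<Sum>e\<le>k. \<phi> (dilation (m ^ Suc e) x) - \<phi> (dilation (m ^ e) x))"
        by (simp add: linear_diff[OF linear_dilation] linear_diff[OF state_linear[OF assms]]
            dilation_dilation mult.commute)
      also have "\<dots> = \<phi> (dilation (m ^ Suc k) x) - \<phi> x"
        using sum_telescope[of "\<lambda>e. - \<phi> (dilation (m ^ e) x)" k] by simp
      finally show ?thesis
        by (simp add: avg_def)
    qed
    moreover have "(\<lambda>k. (\<phi> (dilation (m ^ Suc k) x) - \<phi> x) / real (Suc k)) \<longlonglongrightarrow> 0"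
    proof (rule Lim_null_comparison)
      show "eventually (\<lambda>k. norm ((\<phi> (dilation (m ^ Suc k) x) - \<phi> x) / real (Suc k))
          \<le> 2 * norm x * inverse (real (Suc k))) sequentially"
      proof (intro always_eventually allI)
        fix k
        have "norm (dilation (m ^ Suc k) x) \<le> norm x"
          by (rule norm_bound) (simp only: dilation.rep_eq norm_bounded)
        with state_abs_le_norm[OF assms] have "\<bar>\<phi> (dilation (m ^ Suc k) x)\<bar> \<le> norm x"
          by (rule order_trans)
        then have "\<bar>\<phi> (dilation (m ^ Suc k) x) - \<phi> x\<bar> \<le> 2 * norm x"
          using state_abs_le_norm[OF assms, of x] by linarith
        then show "norm ((\<phi> (dilation (m ^ Suc k) x) - \<phi> x) / real (Suc k))
            \<le> 2 * norm x * inverse (real (Suc k))"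
          by (simp add: divide_inverse abs_mult mult_right_mono)
      qed
      show "(\<lambda>k. 2 * norm x * inverse (real (Suc k))) \<longlonglongrightarrow> 0"
        by (rule tendsto_mult_right_zero[OF LIMSEQ_inverse_real_of_nat])
    qed
    ultimately have "\<psi> (dilation m x - x) = 0"
      by (intro \<psi>(2)) simp
    then show ?thesis
      by (simp add: linear_diff[OF state_linear[OF \<psi>(1)]])
  qed
  moreover have "\<psi> x = 0" if "\<And>e. \<phi> (dilation (m ^ e) x) = 0" for x
    by (rule \<psi>(2)) (simp add: avg_def that)
  ultimately show thesis
    using that \<psi>(1) by blast
qed

text \<open>
  Invariance under \<open>\<sigma>\<^sub>1, \<sigma>\<^sub>2, \<dots>\<close> is added one dilation at a time. Since dilations commute,
  averaging over the powers of the next one keeps the invariance under the earlier ones. The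
  resulting states keep vanishing on \<open>N\<close> because \<open>N\<close> is mapped into itself by dilations, and so does a cluster point
  of their sequence, which has every one of these invariances.
\<close>

theorem dilation_invariant_state:
  assumes "state \<phi>"
  obtains \<psi> where "state \<psi>"
    and "\<And>m x. 1 \<le> m \<Longrightarrow> \<psi> (dilation m x) = \<psi> x"
    and "\<And>x. (\<And>m. 1 \<le> m \<Longrightarrow> \<phi> (dilation m x) = 0) \<Longrightarrow> \<psi> x = 0"
proof -
  define N where "N = {x. \<forall>m\<ge>1. \<phi> (dilation m x) = 0}"
  define P where "P n \<theta> \<longleftrightarrow> state \<theta> \<and> (\<forall>m\<in>{1..n}. \<forall>x. \<theta> (dilation m x) = \<theta> x) \<and>
    (\<forall>x\<in>N. \<theta> x = 0)" for n :: nat and \<theta>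
  have N_dilation: "dilation m x \<in> N" if "x \<in> N" "1 \<le> m" for m x
    using that by (auto simp: N_def dilation_dilation)
  have "\<exists>f. \<forall>n. P n (f n) \<and> True"
  proof (rule dependent_nat_choice)
    have "\<phi> x = 0" if "x \<in> N" for x
      using that by (auto simp: N_def dest: spec[of _ 1])
    then show "\<exists>\<theta>. P 0 \<theta>"
      using assms by (auto simp: P_def)
  next
    fix \<theta> n
    assume \<theta>: "P n \<theta>"
    then have "state \<theta>"
      by (simp add: P_def)
    then obtain \<psi> where \<psi>: "state \<psi>" "\<And>x. \<psi> (dilation (Suc n) x) = \<psi> x"
        "\<And>x. (\<And>e. \<theta> (dilation (Suc n ^ e) x) = 0) \<Longrightarrow> \<psi> x = 0"
      using add_dilation_invariance[of \<theta> "Suc n"] by blast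
    have "\<psi> (dilation m x) = \<psi> x" if "m \<in> {1..n}" for m x
    proof -
      have "\<psi> (dilation m x - x) = 0"
      proof (rule \<psi>(3))
        fix e
        have "dilation (Suc n ^ e) (dilation m x - x) =
            dilation m (dilation (Suc n ^ e) x) - dilation (Suc n ^ e) x"
          by (simp add: linear_diff[OF linear_dilation] dilation_dilation mult.commute[of m])
        then show "\<theta> (dilation (Suc n ^ e) (dilation m x - x)) = 0"
          using \<theta> that by (simp add: P_def linear_diff state_linear)
      qed
      then show ?thesis
        by (simp add: linear_diff[OF state_linear[OF \<psi>(1)]])
    qed
    moreover have "\<psi> x = 0" if "x \<in> N" for x
      using \<theta> N_dilation[OF that] by (intro \<psi>(3)) (simp add: P_def)
    ultimately have "P (Suc n) \<psi>"
      using \<psi>(1,2) by (auto simp: P_def le_Suc_eq)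
    then show "\<exists>\<psi>. P (Suc n) \<psi> \<and> True"
      by blast
  qed
  then obtain f where f: "\<And>n. P n (f n)"
    by blast
  have "\<And>n. state (f n)"
    using f by (simp add: P_def)
  then obtain \<psi> where \<psi>: "state \<psi>" "\<And>x l. (\<lambda>n. f n x) \<longlonglongrightarrow> l \<Longrightarrow> \<psi> x = l"
    using state_cluster_point[of f] by blast
  have "\<psi> (dilation m x) = \<psi> x" if "1 \<le> m" for m x
  proof -
    have "f n (dilation m x - x) = 0" if "m \<le> n" for n
      using f[of n] \<open>1 \<le> m\<close> that by (simp add: P_def linear_diff state_linear)
    then have "(\<lambda>n. f n (dilation m x - x)) \<longlonglongrightarrow> 0"
      by (intro tendsto_eventually) (auto simp: eventually_sequentially)
    then have "\<psi> (dilation m x - x) = 0"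
      by (rule \<psi>(2))
    then show ?thesis
      by (simp add: linear_diff[OF state_linear[OF \<psi>(1)]])
  qed
  moreover have "\<psi> x = 0" if "\<And>m. 1 \<le> m \<Longrightarrow> \<phi> (dilation m x) = 0" for x
    using f that by (intro \<psi>(2)) (simp add: P_def N_def)
  ultimately show thesis
    using that \<psi>(1) by blast
qed

section \<open>Sparse windows and their shadow\<close>

text \<open>
  The factor \<open>(N + 1)\<^sup>4\<close> serves two purposes. It puts window \<open>N + 1\<close>, even when divided by \<open>N + 1\<close>,
  beyond window \<open>N\<close>, and it makes \<open>window_start N\<close> at least \<open>N\<^sup>4\<close>, which exceeds the point count
  \<open>N\<^sup>3\<close> of \<open>card_shadow_initial_segment\<close> by a factor that tends to infinity.
\<close>

primrec window_start :: "nat \<Rightarrow> nat" where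
  "window_start 0 = 1"
| "window_start (Suc N) = (N + 1) ^ 4 * (window_start N + N)"

definition window :: "nat \<Rightarrow> nat set" where
  "window N = {window_start N ..< window_start N + N}"

text \<open>
  In coordinates starting at \<open>0\<close>, \<open>(\<sigma>\<^sub>m x)\<^sub>n = x\<^bsub>n div m\<^esub>\<close>. So the dilation by \<open>m\<close> of the indicator of this
  set is \<open>1\<close> on all windows from the \<open>m\<close>-th on.
\<close>

definition shadow :: "nat set" where
  "shadow = (\<Union>N. \<Union>m\<in>{1..N}. (\<lambda>n. n div m) ` window N)"

lemma card_window [simp]: "card (window N) = N"
  and finite_window [simp]: "finite (window N)"
  by (simp_all add: window_def)

lemma window_start_pos: "1 \<le> window_start N"
  by (induction N) auto

lemma power4_le_window_start: "N ^ 4 \<le> window_start N"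
proof (cases N)
  case (Suc K)
  have "1 \<le> window_start K + K"
    using window_start_pos[of K] by simp
  then have "(K + 1) ^ 4 * 1 \<le> (K + 1) ^ 4 * (window_start K + K)"
    by (rule mult_left_mono) simp
  then show ?thesis
    by (simp add: Suc)
qed simp

lemma window_start_step: "Suc K * (window_start K + K) \<le> window_start (Suc K)"
proof -
  have "Suc K \<le> (K + 1) ^ 4"
    using self_le_power[of "Suc K" 4] by simp
  then show ?thesis
    unfolding window_start.simps by (rule mult_le_mono1)
qed

lemma window_start_mono: "N \<le> K \<Longrightarrow> window_start N \<le> window_start K"
proof (rule lift_Suc_mono_le[of window_start])
  fix n
  have "window_start n \<le> Suc n * (window_start n + n)"
    by simp
  then show "window_start n \<le> window_start (Suc n)"
    using window_start_step by (rule order_trans)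
qed

text \<open>
  Up to \<open>n\<close>, and so up to \<open>n div m\<close>, there is no trace of the windows after \<open>N\<close>: the quotient of an
  element of window \<open>N' > N\<close> by some \<open>m' \<le> N'\<close> lies beyond window \<open>N\<close>. The remaining points are described by the index
  of a window, a divisor and an offset, each taking at most \<open>N\<close> values.
\<close>

lemma shadow_initial_segment:
  assumes "n \<in> window N"
  shows "shadow \<inter> {..n div m} \<subseteq>
    (\<lambda>(N', m', i). (window_start N' + i) div m') ` ({1..N} \<times> {1..N} \<times> {..<N})"
proof
  fix j
  assume "j \<in> shadow \<inter> {..n div m}"
  then obtain N' m' n' where j: "j = n' div m'" "m' \<in> {1..N'}" "n' \<in> window N'" "j \<le> n div m"
    by (auto simp: shadow_def)
  have "N' \<le> N"
  proof (rule ccontr)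
    assume "\<not> N' \<le> N"
    then obtain K where K: "N' = Suc K" "N \<le> K"
      by (cases N') auto
    have "m' * (window_start N + N) \<le> Suc K * (window_start K + K)"
      using j(2) K window_start_mono[OF K(2)] by (intro mult_le_mono) auto
    also have "\<dots> \<le> n'"
      using window_start_step[of K] j(3) by (auto simp: K window_def)
    finally have "window_start N + N \<le> j"
      using j(1,2) by (simp add: less_eq_div_iff_mult_less_eq mult.commute)
    also have "\<dots> \<le> n"
      using j(4) div_le_dividend order_trans by blast
    finally show False
      using assms by (simp add: window_def)
  qed
  moreover obtain i where "n' = window_start N' + i" "i < N'"
    using j(3) by (auto simp: window_def le_iff_add)
  ultimately show "j \<in> (\<lambda>(N', m', i). (window_start N' + i) div m') `
      ({1..N} \<times> {1..N} \<times> {..<N})"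
    using j(1,2) by (intro image_eqI[of _ _ "(N', m', i)"]) auto
qed

lemma card_shadow_initial_segment:
  assumes "n \<in> window N"
  shows "card (shadow \<inter> {..n div m}) \<le> N ^ 3"
proof -
  have "card (shadow \<inter> {..n div m}) \<le> card ({1..N} \<times> {1..N} \<times> {..<N})"
    by (rule surj_card_le[OF _ shadow_initial_segment[OF assms]]) simp
  then show ?thesis
    by (simp add: power3_eq_cube)
qed

context
  includes bcontfun.lifting
begin

lift_definition shadow_seq :: linf is "\<lambda>i. if i \<in> shadow then 1 else 0"
  by (rule bounded_imp_bcontfun_nat) (auto simp: bounded_iff intro!: exI[of _ 1])

end

lemma dilation_shadow_seq_window:
  assumes "n \<in> window N" "1 \<le> m" "m \<le> N"
  shows "apply_bcontfun (dilation m shadow_seq) n = 1"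
proof -
  have "n div m \<in> shadow"
    unfolding shadow_def using assms by (intro UN_I[of N] UN_I[of m] imageI) auto
  then show ?thesis
    by (simp add: dilation.rep_eq shadow_seq.rep_eq)
qed

lemma dilation_cesaro_shadow_seq_nonneg: "0 \<le> apply_bcontfun (dilation m (cesaro shadow_seq)) n"
  by (auto simp: dilation.rep_eq cesaro.rep_eq shadow_seq.rep_eq intro!: divide_nonneg_nonneg sum_nonneg)

text \<open>
  At \<open>n div m\<close>, which is at least about \<open>N\<^sup>4 / m\<close>, the Cesaro mean counts at most \<open>N\<^sup>3\<close> points.
\<close>

lemma dilation_cesaro_shadow_seq_window:
  assumes "n \<in> window N" "1 \<le> m"
  shows "apply_bcontfun (dilation m (cesaro shadow_seq)) n \<le> real m / real N"
proof -
  have "0 < N"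
    using assms by (cases N) (auto simp: window_def)
  have "N ^ 4 \<le> n"
    using assms power4_le_window_start[of N] by (simp add: window_def)
  also have "n < m * (n div m + 1)"
    using assms(2) by (simp add: dividend_less_times_div)
  finally have j: "real N ^ 4 \<le> real m * real (n div m + 1)"
    by (metis less_imp_le of_nat_le_iff of_nat_mult of_nat_power)
  have "apply_bcontfun (dilation m (cesaro shadow_seq)) n =
      real (card (shadow \<inter> {..n div m})) / real (n div m + 1)"
    by (simp add: dilation.rep_eq cesaro.rep_eq shadow_seq.rep_eq sum.If_cases Int_commute
        del: of_nat_add of_nat_Suc)
  also have "\<dots> \<le> real N ^ 3 / real (n div m + 1)"
    using card_shadow_initial_segment[OF assms(1), of m]
    by (intro divide_right_mono) (simp_all flip: of_nat_power)
  also have "\<dots> \<le> real m / real N"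
    using j \<open>0 < N\<close> by (simp add: field_simps eval_nat_numeral)
  finally show ?thesis .
qed

section \<open>Limits of window averages\<close>

lemma state_evaluation: "state (\<lambda>x. apply_bcontfun x n)"
  by (auto simp: state_def const_bcontfun.rep_eq intro!: linearI)

text \<open>
  The index is moved by one because window \<open>0\<close> is empty.
\<close>

definition window_average :: "nat \<Rightarrow> linf \<Rightarrow> real" where
  "window_average N x = (\<Sum>n\<in>window (Suc N). apply_bcontfun x n) / real (Suc N)"

lemma state_window_average: "state (window_average N)"
  using state_average[of "window (Suc N)" "\<lambda>n x. apply_bcontfun x n"] state_evaluation
  by (force simp: window_average_def[abs_def] window_def)

text \<open>
  The sum telescopes to two terms, while the length of the windows tends to infinity.
\<close>

lemma window_average_shift: "(\<lambda>N. window_average N (shift x - x)) \<longlonglongrightarrow> 0"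
proof (rule Lim_null_comparison)
  show "eventually (\<lambda>N. norm (window_average N (shift x - x))
      \<le> 2 * norm x * inverse (real (Suc N))) sequentially"
  proof (intro always_eventually allI)
    fix N
    \<comment> \<open>The window starts after \<open>0\<close>, where \<open>shift\<close> inserts a zero instead of a previous coordinate.\<close>
    obtain a where a: "window_start (Suc N) = Suc a"
      using window_start_pos[of "Suc N"] by (cases "window_start (Suc N)") auto
    have "(\<Sum>n\<in>window (Suc N). apply_bcontfun (shift x - x) n) =
        (\<Sum>n\<in>{a..<a + Suc N}. apply_bcontfun x n - apply_bcontfun x (Suc n))"
      unfolding window_def a add_Suc sum.shift_bounds_Suc_ivl by (simp add: shift.rep_eq)
    also have "\<dots> = apply_bcontfun x a - apply_bcontfun x (a + Suc N)"
      using sum_Suc_diff'[of a "a + Suc N" "\<lambda>n. - apply_bcontfun x n"] by simp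
    finally have "window_average N (shift x - x) =
        (apply_bcontfun x a - apply_bcontfun x (a + Suc N)) / real (Suc N)"
      by (simp add: window_average_def)
    moreover have "\<bar>apply_bcontfun x a - apply_bcontfun x (a + Suc N)\<bar> \<le> 2 * norm x"
      using norm_bounded[of x a] norm_bounded[of x "a + Suc N"]
      unfolding real_norm_def by linarith
    ultimately show "norm (window_average N (shift x - x)) \<le> 2 * norm x * inverse (real (Suc N))"
      by (simp add: divide_inverse abs_mult mult_right_mono)
  qed
  show "(\<lambda>N. 2 * norm x * inverse (real (Suc N))) \<longlonglongrightarrow> 0"
    by (rule tendsto_mult_right_zero[OF LIMSEQ_inverse_real_of_nat])
qed

lemma window_average_shadow:
  assumes "1 \<le> m"
  shows "(\<lambda>N. window_average N (dilation m shadow_seq)) \<longlonglongrightarrow> 1"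
proof (rule tendsto_eventually)
  show "eventually (\<lambda>N. window_average N (dilation m shadow_seq) = 1) sequentially"
    unfolding eventually_sequentially
    using assms
    by (intro exI[of _ m] allI impI)
      (simp add: window_average_def dilation_shadow_seq_window del: of_nat_Suc)
qed

lemma window_average_cesaro_shadow:
  assumes "1 \<le> m"
  shows "(\<lambda>N. window_average N (dilation m (cesaro shadow_seq))) \<longlonglongrightarrow> 0"
proof (rule Lim_null_comparison)
  show "eventually (\<lambda>N. norm (window_average N (dilation m (cesaro shadow_seq)))
      \<le> real m * inverse (real (Suc N))) sequentially"
  proof (intro always_eventually allI)
    fix N
    have "0 \<le> window_average N (dilation m (cesaro shadow_seq))"
      by (intro state_nonneg[OF state_window_average] dilation_cesaro_shadow_seq_nonneg)
    moreover have "(\<Sum>n\<in>window (Suc N). apply_bcontfun (dilation m (cesaro shadow_seq)) n)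
        \<le> real (card (window (Suc N))) * (real m / real (Suc N))"
      by (rule sum_bounded_above) (rule dilation_cesaro_shadow_seq_window[OF _ assms])
    then have "window_average N (dilation m (cesaro shadow_seq)) \<le> real m / real (Suc N)"
      by (simp add: window_average_def divide_right_mono)
    ultimately show "norm (window_average N (dilation m (cesaro shadow_seq)))
        \<le> real m * inverse (real (Suc N))"
      by (simp only: real_norm_def abs_of_nonneg divide_inverse)
  qed
  show "(\<lambda>N. real m * inverse (real (Suc N))) \<longlonglongrightarrow> 0"
    by (rule tendsto_mult_right_zero[OF LIMSEQ_inverse_real_of_nat])
qed

lemma funpow_shift_apply:
  "apply_bcontfun ((shift ^^ k) x) n = (if n < k then 0 else apply_bcontfun x (n - k))"
  by (induction k arbitrary: n) (auto simp: shift.rep_eq)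

text \<open>
  This commutation rule makes \<open>\<phi> \<circ> \<sigma>\<^sub>m\<close> shift-invariant for shift-invariant \<open>\<phi>\<close>.
\<close>

lemma dilation_shift:
  assumes "1 \<le> m"
  shows "dilation m (shift x) = (shift ^^ m) (dilation m x)"
proof (rule bcontfun_eqI)
  fix n
  show "apply_bcontfun (dilation m (shift x)) n =
      apply_bcontfun ((shift ^^ m) (dilation m x)) n"
    using assms div_if[of n m] by (auto simp: dilation.rep_eq shift.rep_eq funpow_shift_apply)
qed

lemma shift_invariant_state_separating_shadow:
  obtains \<phi> where "state \<phi>" and "\<And>x. \<phi> (shift x) = \<phi> x"
    and "\<And>m. 1 \<le> m \<Longrightarrow> \<phi> (dilation m shadow_seq) = 1"
    and "\<And>m. 1 \<le> m \<Longrightarrow> \<phi> (dilation m (cesaro shadow_seq)) = 0"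
proof -
  obtain \<phi> where \<phi>: "state \<phi>" "\<And>x l. (\<lambda>N. window_average N x) \<longlonglongrightarrow> l \<Longrightarrow> \<phi> x = l"
    using state_cluster_point[of window_average] state_window_average by blast
  have "\<phi> (shift x - x) = 0" for x
    by (rule \<phi>(2)[OF window_average_shift])
  then have "\<phi> (shift x) = \<phi> x" for x
    by (simp add: linear_diff[OF state_linear[OF \<phi>(1)]])
  then show thesis
    using that \<phi> window_average_shadow window_average_cesaro_shadow by blast
qed

section \<open>The Banach limit\<close>

lemma banach_limit_of_state:
  assumes "state \<phi>" "\<And>x. \<phi> (shift x) = \<phi> x"
  obtains B where "B \<in> banach_limits" and "\<And>x. blinfun_apply B x = \<phi> x"
proof -
  have "bounded_linear \<phi>"
    using state_linear[OF assms(1)] state_abs_le_norm[OF assms(1)]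
    by (intro bounded_linear_intro[where K = 1]) (auto simp: linear_add linear_scale)
  then have "blinfun_apply (Blinfun \<phi>) = \<phi>"
    by (rule bounded_linear_Blinfun_apply)
  then show thesis
    using that[of "Blinfun \<phi>"] assms by (simp add: banach_limits_def state_def)
qed

theorem theorem4:
  shows "\<exists>B. B \<in> banach_limits
           \<and> B \<in> (\<Inter>m\<in>{2..}. invariant_banach_limits (dilation m))
           \<and> B \<notin> invariant_banach_limits cesaro"
proof -
  obtain \<phi> where \<phi>: "state \<phi>" "\<And>x. \<phi> (shift x) = \<phi> x"
      "\<And>m. 1 \<le> m \<Longrightarrow> \<phi> (dilation m shadow_seq) = 1"
      "\<And>m. 1 \<le> m \<Longrightarrow> \<phi> (dilation m (cesaro shadow_seq)) = 0"
    using shift_invariant_state_separating_shadow by blast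
  obtain \<psi> where \<psi>: "state \<psi>" "\<And>m x. 1 \<le> m \<Longrightarrow> \<psi> (dilation m x) = \<psi> x"
      "\<And>x. (\<And>m. 1 \<le> m \<Longrightarrow> \<phi> (dilation m x) = 0) \<Longrightarrow> \<psi> x = 0"
    using dilation_invariant_state[OF \<phi>(1)] by blast
  note linear_\<phi> = state_linear[OF \<phi>(1)] and linear_\<psi> = state_linear[OF \<psi>(1)]
  have \<phi>_funpow: "\<phi> ((shift ^^ k) x) = \<phi> x" for k x
    by (induction k) (simp_all add: \<phi>(2))
  \<comment> \<open>\<open>\<psi>\<close> is only known through vanishing along the orbit of \<open>\<phi>\<close>, so each property of \<open>\<phi>\<close> is
    transported as the vanishing at a difference.\<close>
  have "\<psi> (shift x - x) = 0" for x
    by (rule \<psi>(3))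
      (simp add: linear_diff[OF linear_dilation] linear_diff[OF linear_\<phi>] dilation_shift \<phi>_funpow)
  then have "\<psi> (shift x) = \<psi> x" for x
    by (simp add: linear_diff[OF linear_\<psi>])
  then obtain B where B: "B \<in> banach_limits" "\<And>x. blinfun_apply B x = \<psi> x"
    using banach_limit_of_state[OF \<psi>(1)] by blast
  have "\<psi> (shadow_seq - const_bcontfun 1) = 0"
    using \<phi>(3) state_one[OF state_dilation[OF \<phi>(1)]]
    by (intro \<psi>(3)) (simp add: linear_diff[OF linear_dilation] linear_diff[OF linear_\<phi>])
  then have "\<psi> shadow_seq = 1"
    by (simp add: linear_diff[OF linear_\<psi>] state_one[OF \<psi>(1)])
  moreover have "\<psi> (cesaro shadow_seq) = 0"
    by (rule \<psi>(3)) (rule \<phi>(4))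
  ultimately have "B \<notin> invariant_banach_limits cesaro"
    by (auto simp: invariant_banach_limits_def B(2) intro!: exI[of _ shadow_seq])
  then show ?thesis
    using B \<psi>(2) by (intro exI[of _ B]) (auto simp: invariant_banach_limits_def)
qed

end
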